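(* Let $(X,\tau)$ be a locally convex space and let $T\in\mathcal{M}(X)$ be locally-NI. Then $[\varphi_{T}=c]=[\varphi_{T}\le c]=[\psi_{T}=c]$, and this set is the unique identifiable extension of $T$.
   Context: $(X,\tau)$ is a non-trivial Hausdorff locally convex space, $X^*$ its dual with weak-star topology $\omega^*$, $Z=X\times X^*$ with topology $\tau\times\omega^*$, $c(x,x^* )=\langle x,x^*\rangle$. Operators are identified with their graphs; $D(T)$ is the domain; $T|_V$ has graph $\operatorname{Graph}T\cap(V\times X^* )$. $\varphi_{T}(x,x^{*})=\sup\{\langle x,u^{*}\rangle+\langle u,x^{*}\rangle-\langle u,u^{*}\rangle\mid(u,u^{*})\in T\}$ ($\sup\emptyset=-\infty$); $\psi_T$ is the $\tau\times\omega^*$-lsc convex hull of $c+\iota_{\operatorname{Graph}T}$; $[f\le g]=\{z\mid f(z)\le g(z)\}$, etc. $\mathcal M(X)$: monotone operators with non-empty graph. $T$ is $V$-NI if $\varphi_{T|_V}\ge c$ on $V\times X^*$, and locally-NI if it is $V$-NI for every open convex $V$ with $V\cap D(T)\ne\emptyset$. $V$ identifies $S$ if $[\varphi_{S|_V}\le c]\cap(V\times X^* )\subset\operatorname{Graph}S$; $S$ is identifiable if every open convex $V$ with $V\cap D(S)\ne\emptyset$ identifies $S$. An extension of $T$ is an operator whose graph contains $\operatorname{Graph}T$.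
   Formalization: Uniqueness is asserted among monotone identifiable extensions of T only; among arbitrary operators it fails, since the operator with graph all of X×X* is trivially an identifiable extension of T. *)

theory Defs
  imports "HOL-Analysis.Analysis"
begin

definition lcs :: "'a::real_vector topology \<Rightarrow> bool" where
  "lcs tau \<longleftrightarrow> topspace tau = UNIV \<and> Hausdorff_space tau
     \<and> continuous_map (prod_topology tau tau) tau (\<lambda>(x, y). x + y)
     \<and> continuous_map (prod_topology euclideanreal tau) tau (\<lambda>(a, x). a *\<^sub>R x)
     \<and> (\<forall>U x. openin tau U \<and> x \<in> U \<longrightarrow> (\<exists>W. openin tau W \<and> convex W \<and> x \<in> W \<and> W \<subseteq> U))
     \<and> (\<exists>x::'a. x \<noteq> 0)"

definition dual :: "'a::real_vector topology \<Rightarrow> ('a \<Rightarrow> real) set" where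
  "dual tau = {f. linear f \<and> continuous_map tau euclideanreal f}"

definition wstar :: "'a::real_vector topology \<Rightarrow> ('a \<Rightarrow> real) topology" where
  "wstar tau = subtopology (powertop_real UNIV) (dual tau)"

definition Ztop :: "'a::real_vector topology \<Rightarrow> ('a \<times> ('a \<Rightarrow> real)) topology" where
  "Ztop tau = prod_topology tau (wstar tau)"

definition Zsp :: "'a::real_vector topology \<Rightarrow> ('a \<times> ('a \<Rightarrow> real)) set" where
  "Zsp tau = UNIV \<times> dual tau"

definition cpl :: "'a \<times> ('a \<Rightarrow> real) \<Rightarrow> real" where
  "cpl z = snd z (fst z)"

text \<open>Operators are identified with their graphs (subsets of Z).\<close>
definition dom_op :: "('a \<times> ('a \<Rightarrow> real)) set \<Rightarrow> 'a set" where
  "dom_op T = fst ` T"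

definition restr :: "('a \<times> ('a \<Rightarrow> real)) set \<Rightarrow> 'a set \<Rightarrow> ('a \<times> ('a \<Rightarrow> real)) set" where
  "restr T V = T \<inter> (V \<times> UNIV)"

definition monotone_op :: "('a::real_vector \<times> ('a \<Rightarrow> real)) set \<Rightarrow> bool" where
  "monotone_op T \<longleftrightarrow> (\<forall>(x, f) \<in> T. \<forall>(y, g) \<in> T. f (x - y) - g (x - y) \<ge> 0)"

definition MX :: "'a::real_vector topology \<Rightarrow> ('a \<times> ('a \<Rightarrow> real)) set set" where
  "MX tau = {T. T \<subseteq> Zsp tau \<and> T \<noteq> {} \<and> monotone_op T}"

text \<open>Fitzpatrick function (sup over empty set is -\<infinity>).\<close>
definition phi :: "('a \<times> ('a \<Rightarrow> real)) set \<Rightarrow> 'a \<times> ('a \<Rightarrow> real) \<Rightarrow> ereal" where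
  "phi T z = (SUP p\<in>T. ereal (snd z (fst p) + snd p (fst z) - snd p (fst p)))"

definition zcomb :: "real \<Rightarrow> 'a::real_vector \<times> ('a \<Rightarrow> real) \<Rightarrow> 'a \<times> ('a \<Rightarrow> real) \<Rightarrow> 'a \<times> ('a \<Rightarrow> real)" where
  "zcomb t z w = (t *\<^sub>R fst z + (1 - t) *\<^sub>R fst w, (\<lambda>v. t * snd z v + (1 - t) * snd w v))"

text \<open>Convexity of an extended-real valued function on Z (via its strict epigraph).\<close>
definition convex_Z :: "'a::real_vector topology \<Rightarrow> ('a \<times> ('a \<Rightarrow> real) \<Rightarrow> ereal) \<Rightarrow> bool" where
  "convex_Z tau h \<longleftrightarrow> (\<forall>z\<in>Zsp tau. \<forall>w\<in>Zsp tau. \<forall>t a b. 0 < t \<and> t < 1 \<and> h z < ereal a \<and> h w < ereal b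
      \<longrightarrow> h (zcomb t z w) < ereal (t * a + (1 - t) * b))"

definition lsc_Z :: "'a::real_vector topology \<Rightarrow> ('a \<times> ('a \<Rightarrow> real) \<Rightarrow> ereal) \<Rightarrow> bool" where
  "lsc_Z tau h \<longleftrightarrow> (\<forall>a::real. closedin (Ztop tau) {z \<in> Zsp tau. h z \<le> ereal a})"

definition c_plus_ind :: "('a \<times> ('a \<Rightarrow> real)) set \<Rightarrow> 'a \<times> ('a \<Rightarrow> real) \<Rightarrow> ereal" where
  "c_plus_ind T z = (if z \<in> T then ereal (cpl z) else \<infinity>)"

definition psi :: "'a::real_vector topology \<Rightarrow> ('a \<times> ('a \<Rightarrow> real)) set \<Rightarrow> 'a \<times> ('a \<Rightarrow> real) \<Rightarrow> ereal" where
  "psi tau T z = (SUP h\<in>{h. convex_Z tau h \<and> lsc_Z tau h \<and> (\<forall>w\<in>Zsp tau. h w \<le> c_plus_ind T w)}. h z)"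

definition open_convex :: "'a::real_vector topology \<Rightarrow> 'a set \<Rightarrow> bool" where
  "open_convex tau V \<longleftrightarrow> openin tau V \<and> convex V"

definition V_NI :: "'a::real_vector topology \<Rightarrow> 'a set \<Rightarrow> ('a \<times> ('a \<Rightarrow> real)) set \<Rightarrow> bool" where
  "V_NI tau V T \<longleftrightarrow> (\<forall>z \<in> V \<times> dual tau. phi (restr T V) z \<ge> ereal (cpl z))"

definition locally_NI :: "'a::real_vector topology \<Rightarrow> ('a \<times> ('a \<Rightarrow> real)) set \<Rightarrow> bool" where
  "locally_NI tau T \<longleftrightarrow> (\<forall>V. open_convex tau V \<and> V \<inter> dom_op T \<noteq> {} \<longrightarrow> V_NI tau V T)"

definition identifies :: "'a::real_vector topology \<Rightarrow> 'a set \<Rightarrow> ('a \<times> ('a \<Rightarrow> real)) set \<Rightarrow> bool" where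
  "identifies tau V S \<longleftrightarrow> {z \<in> V \<times> dual tau. phi (restr S V) z \<le> ereal (cpl z)} \<subseteq> S"

definition identifiable :: "'a::real_vector topology \<Rightarrow> ('a \<times> ('a \<Rightarrow> real)) set \<Rightarrow> bool" where
  "identifiable tau S \<longleftrightarrow> (\<forall>V. open_convex tau V \<and> V \<inter> dom_op S \<noteq> {} \<longrightarrow> identifies tau V S)"

end

theory Submission
  imports Defs "HOL-Library.Function_Algebras"
begin

text \<open>
  If \<open>T\<close> is \<open>V\<close>-NI and \<open>z \<in> V \<times> X*\<close> satisfies \<open>\<phi> (T|V) z \<le> c z\<close>, then \<open>\<psi> (T|V) z \<le> c z\<close>: otherwise
  Hahn--Banach separates \<open>(z, c z)\<close> from the epigraph of a convex lsc minorant of \<open>c + \<iota> (T|V)\<close>, and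
  moving \<open>z\<close> slightly in the direction of the separating functional makes \<open>\<phi> (T|V)\<close> drop below \<open>c\<close>,
  because \<open>c\<close> changes only to second order relative to the affine bound. Hence
  \<open>\<phi> T z \<le> \<psi> T z \<le> \<psi> (T|V) z \<le> c z\<close>, so being monotonically related to \<open>T|V\<close> already forces being
  monotonically related to \<open>T\<close>. Applying the same perturbation on a thin tube around a segment from
  a point \<open>x \<in> D(S)\<close> to a point of \<open>D(T)\<close> shows that \<open>D(T)\<close> is dense in \<open>D(S)\<close>, so the open convex
  sets that must identify \<open>S\<close> all meet \<open>D(T)\<close>.
\<close>

section \<open>Hahn--Banach separation\<close>

text \<open>The weak-star topology is that of pointwise convergence, so the separation argument
  takes the space of all real functions on X as its ambient vector space.\<close>

instantiation "fun" :: (type, real_vector) real_vector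
begin

definition "scaleR_fun a f = (\<lambda>x. a *\<^sub>R f x)" for f :: "'a \<Rightarrow> 'b"

instance
  by standard (simp_all add: scaleR_fun_def fun_eq_iff scaleR_add_right scaleR_add_left)

end

lemma scaleR_fun_apply [simp]: "(a *\<^sub>R f) x = a *\<^sub>R f x"
  by (simp add: scaleR_fun_def)

definition sublinear :: "('b::real_vector \<Rightarrow> real) \<Rightarrow> bool" where
  "sublinear q \<longleftrightarrow> (\<forall>x y. q (x + y) \<le> q x + q y) \<and> (\<forall>a x. 0 < a \<longrightarrow> q (a *\<^sub>R x) = a * q x)"

lemma sublinear_add: "sublinear q \<Longrightarrow> q (x + y) \<le> q x + q y"
  by (simp add: sublinear_def)

lemma sublinear_scale_pos: "sublinear q \<Longrightarrow> 0 < a \<Longrightarrow> q (a *\<^sub>R x) = a * q x"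
  by (simp add: sublinear_def)

lemma sublinear_zero: "sublinear q \<Longrightarrow> q 0 = 0"
  using sublinear_scale_pos[of q 2 0] by simp

lemma sublinear_scale: "sublinear q \<Longrightarrow> 0 \<le> a \<Longrightarrow> q (a *\<^sub>R x) = a * q x"
  by (cases "a = 0") (simp_all add: sublinear_zero sublinear_scale_pos)

lemma sublinear_minus: "sublinear q \<Longrightarrow> - q (- x) \<le> q x"
  using sublinear_add[of q x "- x"] sublinear_zero[of q] by simp

lemma sublinearI:
  assumes "\<And>x y. q (x + y) \<le> q x + q y" "\<And>a x. 0 < a \<Longrightarrow> q (a *\<^sub>R x) \<le> a * q x"
  shows "sublinear q"
  unfolding sublinear_def
proof (intro conjI allI impI antisym)
  fix a :: real and x assume a: "0 < a"
  have "q x \<le> (1 / a) * q (a *\<^sub>R x)" using assms(2)[of "1 / a" "a *\<^sub>R x"] a by simp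
  then show "a * q x \<le> q (a *\<^sub>R x)" using a by (simp add: field_simps)
qed (use assms in auto)

text \<open>Take the infimum of \<open>q (x + t *\<^sub>R c) - t * k\<close> over t >= 0 and c in C.
  It is finite because \<open>t * k\<close> is at most q (t c), and subadditivity bounds every term
  below by - q (- x). Taking t = 0 gives the bound by q; taking t = 1 at the point - c gives the
  bound - k.\<close>

lemma sublinear_reduce:
  fixes q :: "'b::real_vector \<Rightarrow> real"
  assumes q: "sublinear q" and C: "convex C" "C \<noteq> {}" and k: "\<And>c. c \<in> C \<Longrightarrow> k \<le> q c"
  obtains q' where "sublinear q'" "\<And>x. q' x \<le> q x" "\<And>c. c \<in> C \<Longrightarrow> q' (- c) \<le> - k"
proof -
  define G where "G x = {q (x + t *\<^sub>R c) - t * k | t c. 0 \<le> t \<and> c \<in> C}" for x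
  define q' where "q' x = Inf (G x)" for x
  have ge: "- q (- x) \<le> r" if r: "r \<in> G x" for r x
  proof -
    obtain t c where tc: "r = q (x + t *\<^sub>R c) - t * k" "0 \<le> t" "c \<in> C"
      using r by (auto simp: G_def)
    have "t * k \<le> t * q c" using tc k by (simp add: mult_left_mono)
    also have "\<dots> = q ((x + t *\<^sub>R c) + - x)" using q tc by (simp add: sublinear_scale)
    also have "\<dots> \<le> q (x + t *\<^sub>R c) + q (- x)" by (rule sublinear_add[OF q])
    finally show ?thesis using tc by simp
  qed
  have bdd: "bdd_below (G x)" for x using ge by (meson bdd_belowI)
  have ne: "G x \<noteq> {}" for x using C(2) by (auto simp: G_def intro: exI[of _ "0::real"])
  have le: "q' x \<le> q (x + t *\<^sub>R c) - t * k" if "0 \<le> t" "c \<in> C" for x t c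
    unfolding q'_def by (rule cInf_lower[OF _ bdd]) (use that in \<open>auto simp: G_def\<close>)
  show thesis
  proof
    show "sublinear q'"
    proof (rule sublinearI)
      fix x y
      have *: "q' (x + y) \<le> r + s" if rs: "r \<in> G x" "s \<in> G y" for r s
      proof -
        obtain t c where tc: "r = q (x + t *\<^sub>R c) - t * k" "0 \<le> t" "c \<in> C"
          using rs(1) by (auto simp: G_def)
        obtain u d where ud: "s = q (y + u *\<^sub>R d) - u * k" "0 \<le> u" "d \<in> C"
          using rs(2) by (auto simp: G_def)
        \<comment> \<open>Convexity merges the two rays: e is the mean of c and d with weights
          proportional to t and u. If both weights vanish, any point of C serves.\<close>
        obtain e where e: "e \<in> C" "(t + u) *\<^sub>R e = t *\<^sub>R c + u *\<^sub>R d"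
        proof (cases "t + u = 0")
          case True
          then have "t = 0" "u = 0" using tc ud by auto
          then show ?thesis using that[of c] tc by simp
        next
          case False
          then have pos: "0 < t + u" using tc ud by simp
          have "(t / (t + u)) *\<^sub>R c + (u / (t + u)) *\<^sub>R d \<in> C"
            using C(1) tc ud pos by (intro convexD) (auto simp: add_divide_distrib[symmetric])
          then show ?thesis using that False by (simp add: scaleR_add_right)
        qed
        have "q' (x + y) \<le> q ((x + y) + (t + u) *\<^sub>R e) - (t + u) * k"
          using tc ud e by (intro le) auto
        also have "(x + y) + (t + u) *\<^sub>R e = (x + t *\<^sub>R c) + (y + u *\<^sub>R d)"
          using e by simp
        also have "q \<dots> \<le> q (x + t *\<^sub>R c) + q (y + u *\<^sub>R d)" by (rule sublinear_add[OF q])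
        finally show ?thesis using tc ud by (simp add: algebra_simps)
      qed
      have "q' (x + y) - s \<le> q' x" if "s \<in> G y" for s
        unfolding q'_def[of x] by (rule cInf_greatest[OF ne]) (use *[OF _ that] in \<open>simp add: diff_le_eq\<close>)
      then have "q' (x + y) - q' x \<le> q' y"
        unfolding q'_def[of y] by (intro cInf_greatest[OF ne]) (simp add: algebra_simps)
      then show "q' (x + y) \<le> q' x + q' y" by simp
    next
      fix a :: real and x assume a: "0 < a"
      have "q' (a *\<^sub>R x) / a \<le> r" if r: "r \<in> G x" for r
      proof -
        obtain t c where tc: "r = q (x + t *\<^sub>R c) - t * k" "0 \<le> t" "c \<in> C"
          using r by (auto simp: G_def)
        have "q' (a *\<^sub>R x) \<le> q (a *\<^sub>R x + (a * t) *\<^sub>R c) - (a * t) * k"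
          using le tc a by simp
        also have "a *\<^sub>R x + (a * t) *\<^sub>R c = a *\<^sub>R (x + t *\<^sub>R c)"
          by (simp add: scaleR_add_right)
        also have "q \<dots> = a * q (x + t *\<^sub>R c)" using q a by (rule sublinear_scale_pos)
        finally have "q' (a *\<^sub>R x) \<le> a * r" unfolding tc(1) by (simp add: algebra_simps)
        then show ?thesis using a by (simp add: field_simps)
      qed
      then have "q' (a *\<^sub>R x) / a \<le> q' x"
        unfolding q'_def[of x] by (intro cInf_greatest[OF ne])
      then show "q' (a *\<^sub>R x) \<le> a * q' x" using a by (simp add: field_simps)
    qed
    show "q' x \<le> q x" for x using le[of 0 _ x] C(2) by auto
    show "q' (- c) \<le> - k" if "c \<in> C" for c
      using le[of 1 c "- c"] that sublinear_zero[OF q] by simp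
  qed
qed

text \<open>Zorn for the reversed pointwise order. Every sublinear minorant of p lies above - p (-
  x), so a nonempty chain has a finite pointwise infimum; it is subadditive because any two members
  of the chain have a common lower one in it.\<close>

lemma ex_minimal_sublinear:
  fixes p :: "'b::real_vector \<Rightarrow> real"
  assumes p: "sublinear p"
  obtains m where "sublinear m" "m \<le> p" "\<And>q. sublinear q \<Longrightarrow> q \<le> m \<Longrightarrow> q = m"
proof -
  define A where "A = {q. sublinear q \<and> q \<le> p}"
  define R where "R = relation_of (\<lambda>f g. g \<le> f) A"
  have "partial_order_on A R"
    unfolding R_def by (rule partial_order_on_relation_ofI) auto
  moreover have "\<exists>u\<in>A. \<forall>a\<in>Ch. u \<le> a" if Ch: "Ch \<in> Chains R" for Ch
  proof (cases "Ch = {}")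
    case True
    then show ?thesis using p by (auto simp: A_def)
  next
    case False
    have ChA: "Ch \<subseteq> A" and tot: "\<And>a b. a \<in> Ch \<Longrightarrow> b \<in> Ch \<Longrightarrow> a \<le> b \<or> b \<le> a"
      using Ch by (auto simp: Chains_def R_def relation_of_def)
    define u where "u x = (INF q\<in>Ch. q x)" for x
    have "- p (- x) \<le> q x" if "q \<in> Ch" for q x
    proof -
      have "sublinear q" "q (- x) \<le> p (- x)" using that ChA by (auto simp: A_def le_fun_def)
      then show ?thesis using sublinear_minus[of q x] by linarith
    qed
    then have bdd: "bdd_below ((\<lambda>q. q x) ` Ch)" for x by (meson bdd_belowI2)
    have le: "u x \<le> q x" if "q \<in> Ch" for q x
      unfolding u_def by (rule cINF_lower[OF bdd that])
    have "sublinear u"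
    proof (rule sublinearI)
      fix x y
      have *: "u (x + y) \<le> q x + r y" if qr: "q \<in> Ch" "r \<in> Ch" for q r
      proof -
        obtain s where s: "s \<in> Ch" "s \<le> q" "s \<le> r" using tot[OF qr] qr by blast
        have "u (x + y) \<le> s (x + y)" by (rule le[OF s(1)])
        also have "\<dots> \<le> s x + s y" using s ChA by (auto simp: A_def intro: sublinear_add)
        also have "\<dots> \<le> q x + r y" using s by (intro add_mono) (auto simp: le_fun_def)
        finally show ?thesis .
      qed
      have "u (x + y) - r y \<le> u x" if "r \<in> Ch" for r
        unfolding u_def[of x] by (rule cINF_greatest[OF False]) (use *[OF _ that] in \<open>simp add: diff_le_eq\<close>)
      then have "u (x + y) - u x \<le> u y"
        unfolding u_def[of y] by (intro cINF_greatest[OF False]) (simp add: algebra_simps)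
      then show "u (x + y) \<le> u x + u y" by simp
    next
      fix a :: real and x assume a: "0 < a"
      have "u (a *\<^sub>R x) / a \<le> q x" if "q \<in> Ch" for q
      proof -
        have "sublinear q" using that ChA by (auto simp: A_def)
        then show ?thesis using le[OF that, of "a *\<^sub>R x"] a by (simp add: sublinear_scale_pos field_simps)
      qed
      then have "u (a *\<^sub>R x) / a \<le> u x"
        unfolding u_def[of x] by (intro cINF_greatest[OF False])
      then show "u (a *\<^sub>R x) \<le> a * u x" using a by (simp add: field_simps)
    qed
    moreover have "u \<le> p"
    proof -
      obtain q where "q \<in> Ch" using False by blast
      then show ?thesis using le[of q] ChA by (force simp: A_def le_fun_def intro: order_trans)
    qed
    ultimately show ?thesis using le by (auto simp: A_def le_fun_def)
  qed
  ultimately obtain m where "m \<in> A" "\<forall>a\<in>A. a \<le> m \<longrightarrow> a = m"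
    unfolding R_def using predicate_Zorn[of A "\<lambda>f g. g \<le> f"] by blast
  then show thesis using that[of m] by (auto simp: A_def intro: order_trans)
qed

text \<open>Lowering m along the single point y at level m y cannot change a minimal m, so m (- y)
  <= - m y. Oddness then turns subadditivity into additivity and carries homogeneity over to
  negative scalars.\<close>

lemma minimal_sublinear_imp_linear:
  fixes m :: "'b::real_vector \<Rightarrow> real"
  assumes m: "sublinear m" and min: "\<And>q. sublinear q \<Longrightarrow> q \<le> m \<Longrightarrow> q = m"
  shows "linear m"
proof -
  have neg: "m (- y) = - m y" for y
  proof -
    obtain q' where "sublinear q'" "\<And>x. q' x \<le> m x" "\<And>c. c \<in> {y} \<Longrightarrow> q' (- c) \<le> - m y"
      using sublinear_reduce[OF m, of "{y}" "m y"] by auto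
    then have "m (- y) \<le> - m y" using min[of q'] by (auto simp: le_fun_def)
    then show ?thesis using sublinear_minus[OF m, of y] by simp
  qed
  have add: "m (x + y) = m x + m y" for x y
    using sublinear_add[OF m, of x y] sublinear_add[OF m, of "x + y" "- y"] neg[of y] by simp
  have "m (a *\<^sub>R x) = a * m x" for a x
  proof (cases "0 \<le> a")
    case True
    then show ?thesis by (rule sublinear_scale[OF m])
  next
    case False
    then show ?thesis using neg[of "(- a) *\<^sub>R x"] sublinear_scale[OF m, of "- a" x] by simp
  qed
  then show ?thesis using add by (intro linearI) auto
qed

text \<open>Hahn--Banach in Mazur--Orlicz form: first lower \<open>p\<close> along \<open>- C\<close>, then pass to a minimal
  sublinear minorant, which is linear.\<close>

lemma Hahn_Banach_separation:
  fixes p :: "'b::real_vector \<Rightarrow> real"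
  assumes p: "sublinear p" and C: "convex C" "C \<noteq> {}" and k: "\<And>c. c \<in> C \<Longrightarrow> k \<le> p c"
  obtains f where "linear f" "\<And>x. f x \<le> p x" "\<And>c. c \<in> C \<Longrightarrow> k \<le> f c"
proof -
  obtain q where q: "sublinear q" "\<And>x. q x \<le> p x" "\<And>c. c \<in> C \<Longrightarrow> q (- c) \<le> - k"
    using sublinear_reduce[OF p C k] by blast
  obtain f where f: "sublinear f" "f \<le> q" "\<And>r. sublinear r \<Longrightarrow> r \<le> f \<Longrightarrow> r = f"
    using ex_minimal_sublinear[OF q(1)] by blast
  have lin: "linear f" by (rule minimal_sublinear_imp_linear[OF f(1,3)])
  show thesis
  proof
    show "linear f" by (rule lin)
    show "f x \<le> p x" for x using f(2) q(2)[of x] by (auto simp: le_fun_def intro: order_trans)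
    show "k \<le> f c" if "c \<in> C" for c
    proof -
      have "f (- c) \<le> - k" using f(2) q(3)[OF that] by (auto simp: le_fun_def intro: order_trans)
      then show ?thesis using linear_neg[OF lin, of c] by simp
    qed
  qed
qed

section \<open>Locally convex spaces\<close>

text \<open>The Minkowski functional. The set under \<open>Inf\<close> is non-empty only if some
  positive multiple of x lies in U, which is why absorption reappears as a hypothesis below.\<close>

definition gauge_fun :: "'b::real_vector set \<Rightarrow> 'b \<Rightarrow> real" where
  "gauge_fun U x = Inf {t. 0 < t \<and> (1 / t) *\<^sub>R x \<in> U}"

lemma gauge_fun_le: "0 < t \<Longrightarrow> (1 / t) *\<^sub>R x \<in> U \<Longrightarrow> gauge_fun U x \<le> t"
  unfolding gauge_fun_def by (rule cInf_lower) (auto intro: bdd_belowI[of _ 0])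

lemma gauge_fun_lessD:
  assumes "gauge_fun U x < r" and abs: "\<exists>t>0. (1 / t) *\<^sub>R x \<in> U"
  obtains t where "0 < t" "t < r" "(1 / t) *\<^sub>R x \<in> U"
proof -
  have "{t. 0 < t \<and> (1 / t) *\<^sub>R x \<in> U} \<noteq> {}" using abs by blast
  from cInf_lessD[OF this] assms(1) that show thesis unfolding gauge_fun_def by blast
qed

lemma gauge_fun_less_one_imp_mem:
  assumes U: "convex U" "0 \<in> U" and "gauge_fun U x < 1" "\<exists>t>0. (1 / t) *\<^sub>R x \<in> U"
  shows "x \<in> U"
proof -
  obtain t where t: "0 < t" "t < 1" "(1 / t) *\<^sub>R x \<in> U" using gauge_fun_lessD assms(3,4) by blast
  have "t *\<^sub>R ((1 / t) *\<^sub>R x) + (1 - t) *\<^sub>R 0 \<in> U" using U t by (intro convexD) auto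
  then show ?thesis using t by simp
qed

lemma sublinear_gauge_fun:
  fixes U :: "'b::real_vector set"
  assumes U: "convex U" and abs: "\<And>x. \<exists>t>0. (1 / t) *\<^sub>R x \<in> U"
  shows "sublinear (gauge_fun U)"
proof (rule sublinearI)
  fix x y
  show "gauge_fun U (x + y) \<le> gauge_fun U x + gauge_fun U y"
  proof (rule field_le_epsilon)
    fix e :: real assume "0 < e"
    then have *: "gauge_fun U x < gauge_fun U x + e / 2" "gauge_fun U y < gauge_fun U y + e / 2" by auto
    obtain t where t: "0 < t" "t < gauge_fun U x + e / 2" "(1 / t) *\<^sub>R x \<in> U"
      using gauge_fun_lessD[OF *(1) abs] by blast
    obtain s where s: "0 < s" "s < gauge_fun U y + e / 2" "(1 / s) *\<^sub>R y \<in> U"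
      using gauge_fun_lessD[OF *(2) abs] by blast
    have "(t / (t + s)) *\<^sub>R ((1 / t) *\<^sub>R x) + (s / (t + s)) *\<^sub>R ((1 / s) *\<^sub>R y) \<in> U"
      using U t s by (intro convexD) (auto simp: add_divide_distrib[symmetric])
    then have "(1 / (t + s)) *\<^sub>R (x + y) \<in> U" using t s by (simp add: scaleR_add_right)
    then have "gauge_fun U (x + y) \<le> t + s" using t s by (intro gauge_fun_le) auto
    then show "gauge_fun U (x + y) \<le> gauge_fun U x + gauge_fun U y + e" using t s by simp
  qed
next
  fix a :: real and x assume a: "0 < a"
  show "gauge_fun U (a *\<^sub>R x) \<le> a * gauge_fun U x"
  proof (rule field_le_epsilon)
    fix e :: real assume e: "0 < e"
    then have "gauge_fun U x < gauge_fun U x + e / a" using a by simp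
    then obtain t where t: "0 < t" "t < gauge_fun U x + e / a" "(1 / t) *\<^sub>R x \<in> U"
      using gauge_fun_lessD[OF _ abs] by blast
    have "gauge_fun U (a *\<^sub>R x) \<le> a * t" using a t by (intro gauge_fun_le) auto
    also have "\<dots> \<le> a * (gauge_fun U x + e / a)" using a t by simp
    finally show "gauge_fun U (a *\<^sub>R x) \<le> a * gauge_fun U x + e"
      using a by (simp add: distrib_left)
  qed
qed

lemma lcs_topspace: "lcs tau \<Longrightarrow> topspace tau = UNIV"
  by (simp add: lcs_def)

lemma lcs_continuous_affine:
  fixes tau :: "'a::real_vector topology"
  assumes "lcs tau"
  shows "continuous_map tau tau (\<lambda>y. a *\<^sub>R y + b)"
proof -
  have add: "continuous_map (prod_topology tau tau) tau (\<lambda>(x, y). x + y)"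
    and scale: "continuous_map (prod_topology euclideanreal tau) tau (\<lambda>(a, x). a *\<^sub>R x)"
    and top: "topspace tau = UNIV"
    using assms by (auto simp: lcs_def)
  have "continuous_map tau (prod_topology euclideanreal tau) (\<lambda>y. (a, y))"
    by (intro continuous_map_pairedI) (auto simp: top)
  from continuous_map_compose[OF this scale]
  have "continuous_map tau tau (\<lambda>y. a *\<^sub>R y)" by (simp add: o_def)
  then have "continuous_map tau (prod_topology tau tau) (\<lambda>y. (a *\<^sub>R y, b))"
    by (intro continuous_map_pairedI) (auto simp: top)
  from continuous_map_compose[OF this add] show ?thesis by (simp add: o_def)
qed

lemma lcs_openin_affine_vimage:
  assumes "lcs tau" "openin tau U"
  shows "openin tau {y. a *\<^sub>R y + b \<in> U}"
  using openin_continuous_map_preimage[OF lcs_continuous_affine[OF assms(1)] assms(2)]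
  by (simp add: lcs_topspace[OF assms(1)])

lemma lcs_open_line:
  fixes tau :: "'a::real_vector topology"
  assumes "lcs tau" "openin tau U"
  shows "open {t. x + t *\<^sub>R y \<in> U}"
proof -
  have scale: "continuous_map (prod_topology euclideanreal tau) tau (\<lambda>(a, x). a *\<^sub>R x)"
    and top: "topspace tau = UNIV"
    using assms by (auto simp: lcs_def)
  have "continuous_map euclideanreal (prod_topology euclideanreal tau) (\<lambda>t. (t, y))"
    by (intro continuous_map_pairedI) (auto simp: top)
  from continuous_map_compose[OF continuous_map_compose[OF this scale] lcs_continuous_affine[OF assms(1), of 1 x]]
  have "continuous_map euclideanreal tau (\<lambda>t. t *\<^sub>R y + x)" by (simp add: o_def)
  from openin_continuous_map_preimage[OF this assms(2)] show ?thesis by (simp add: add.commute)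
qed

lemma lcs_absorbing:
  fixes tau :: "'a::real_vector topology"
  assumes "lcs tau" "openin tau U" "0 \<in> U"
  shows "\<exists>t>0. (1 / t) *\<^sub>R x \<in> U"
proof -
  obtain e where e: "e > 0" "ball 0 e \<subseteq> {t. 0 + t *\<^sub>R x \<in> U}"
    using openE[OF lcs_open_line[OF assms(1,2), of 0 x], of 0] assms(3) by auto
  then have "e / 2 \<in> ball 0 e" by simp
  then have "(e / 2) *\<^sub>R x \<in> U" using e(2) by (auto simp: subset_iff)
  then show ?thesis using e by (intro exI[of _ "2 / e"]) auto
qed

text \<open>A one-sided bound on U suffices: the neighbourhood N of x puts both (2/e)(y - x) and its
  negative in U, so f varies by at most e/2 on N.\<close>

lemma dual_if_bounded_above:
  fixes tau :: "'a::real_vector topology"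
  assumes lcs: "lcs tau" and U: "openin tau U" "0 \<in> U" and f: "linear f" "\<And>x. x \<in> U \<Longrightarrow> f x \<le> 1"
  shows "f \<in> dual tau"
proof -
  have "openin tau {x. f x \<in> B}" if B: "open B" for B
  proof (subst openin_subopen, intro ballI)
    fix x assume x: "x \<in> {x. f x \<in> B}"
    then obtain e where e: "0 < e" "ball (f x) e \<subseteq> B" using openE[OF B, of "f x"] by auto
    define N where "N = {y. (2 / e) *\<^sub>R y + (- (2 / e)) *\<^sub>R x \<in> U} \<inter> {y. (- (2 / e)) *\<^sub>R y + (2 / e) *\<^sub>R x \<in> U}"
    have "openin tau N" unfolding N_def using lcs_openin_affine_vimage[OF lcs U(1)] by blast
    moreover have "x \<in> N" using U(2) by (simp add: N_def)
    moreover have "f y \<in> B" if "y \<in> N" for y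
    proof -
      have "f ((2 / e) *\<^sub>R y + (- (2 / e)) *\<^sub>R x) \<le> 1" "f ((- (2 / e)) *\<^sub>R y + (2 / e) *\<^sub>R x) \<le> 1"
        using that f(2) by (auto simp: N_def)
      then have "(2 / e) * (f y - f x) \<le> 1" "(2 / e) * (f x - f y) \<le> 1"
        by (simp_all add: linear_add[OF f(1)] linear_diff[OF f(1)] linear_neg[OF f(1)] linear_scale[OF f(1)] algebra_simps diff_divide_distrib)
      then have "f y - f x \<le> e / 2" "f x - f y \<le> e / 2" using e(1) by (simp_all add: field_simps)
      then have "f y \<in> ball (f x) e" using e(1) by (simp add: dist_real_def)
      then show ?thesis using e(2) by blast
    qed
    ultimately show "\<exists>N. openin tau N \<and> x \<in> N \<and> N \<subseteq> {x. f x \<in> B}" by blast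
  qed
  then show ?thesis using f(1) by (auto simp: dual_def continuous_map_def lcs_topspace[OF lcs])
qed

text \<open>A basic open set of the product restricts finitely many coordinates; F collects these,
  and e is the least of the radii available there.\<close>

lemma wstar_neighbourhood:
  assumes W: "openin (wstar tau) W" "f \<in> W"
  obtains F e where "finite F" "0 < e" "\<And>g. g \<in> dual tau \<Longrightarrow> (\<And>v. v \<in> F \<Longrightarrow> \<bar>g v - f v\<bar> < e) \<Longrightarrow> g \<in> W"
proof -
  obtain B where B: "openin (powertop_real UNIV) B" "W = B \<inter> dual tau"
    using W(1) by (auto simp: wstar_def openin_subtopology)
  obtain X where X: "f \<in> (\<Pi>\<^sub>E i\<in>UNIV. X i)" "\<And>i. openin euclideanreal (X i)"
      "finite {i. X i \<noteq> topspace euclideanreal}" "(\<Pi>\<^sub>E i\<in>UNIV. X i) \<subseteq> B"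
    using product_topology_open_contains_basis[OF B(1)] W(2) B(2) by blast
  define F where "F = {i. X i \<noteq> UNIV}"
  have F: "finite F" using X(3) by (simp add: F_def)
  have "\<exists>e>0. ball (f i) e \<subseteq> X i" for i
  proof -
    have "open (X i)" "f i \<in> X i" using X(1,2) by (auto simp: PiE_iff)
    then show ?thesis by (meson openE)
  qed
  then obtain d where d: "\<And>i. d i > 0" "\<And>i. ball (f i) (d i) \<subseteq> X i" by metis
  \<comment> \<open>Inserting 1 keeps the minimum well defined when F is empty.\<close>
  define e where "e = Min (insert 1 (d ` F))"
  have e: "0 < e" "\<And>i. i \<in> F \<Longrightarrow> e \<le> d i" using F d(1) by (auto simp: e_def)
  show thesis
  proof
    show "finite F" "0 < e" by (fact F, fact e(1))
    fix g assume g: "g \<in> dual tau" "\<And>v. v \<in> F \<Longrightarrow> \<bar>g v - f v\<bar> < e"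
    have "g i \<in> X i" for i
    proof (cases "i \<in> F")
      case True
      then have "g i \<in> ball (f i) (d i)" using g(2)[OF True] e(2)[OF True] by (simp add: dist_real_def abs_minus_commute)
      then show ?thesis using d(2) by blast
    qed (auto simp: F_def)
    then show "g \<in> W" using X(4) B(2) g(1) by (auto simp: PiE_iff)
  qed
qed

text \<open>Supplies a sublinear functional that can dominate in Hahn-Banach. Intersecting a convex
  neighbourhood of 0 with its negative gives the symmetry that later bounds the gauge of both v and
  - v.\<close>

lemma lcs_gauge_neighbourhood:
  fixes tau :: "'a::real_vector topology"
  assumes lcs: "lcs tau" and W: "openin tau W" "x \<in> W"
  obtains U where "openin tau U" "convex U" "0 \<in> U" "\<And>y. y \<in> U \<Longrightarrow> - y \<in> U"
    "\<And>y. gauge_fun U (y - x) < 1 \<Longrightarrow> y \<in> W" "sublinear (gauge_fun U)"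
proof -
  have "openin tau {y. 1 *\<^sub>R y + x \<in> W}" using lcs_openin_affine_vimage[OF lcs W(1)] .
  moreover have "0 \<in> {y. 1 *\<^sub>R y + x \<in> W}" using W(2) by simp
  ultimately obtain B where B: "openin tau B" "convex B" "0 \<in> B" "B \<subseteq> {y. 1 *\<^sub>R y + x \<in> W}"
    using lcs unfolding lcs_def by metis
  define U where "U = B \<inter> {y. (- 1) *\<^sub>R y + 0 \<in> B}"
  have U: "openin tau U" unfolding U_def using B(1) lcs_openin_affine_vimage[OF lcs B(1)] by blast
  have "{y. (- 1) *\<^sub>R y + 0 \<in> B} = uminus ` B" by (simp add: image_def set_eq_iff) (metis minus_minus)
  then have cU: "convex U" unfolding U_def using B(2) by (simp add: convex_Int convex_negations)
  have 0: "0 \<in> U" using B(3) by (simp add: U_def)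
  note abs = lcs_absorbing[OF lcs U 0]
  show thesis
  proof
    show "openin tau U" "convex U" "0 \<in> U" by fact+
    show "- y \<in> U" if "y \<in> U" for y using that by (simp add: U_def)
    show "sublinear (gauge_fun U)" by (rule sublinear_gauge_fun[OF cU abs])
    show "y \<in> W" if "gauge_fun U (y - x) < 1" for y
    proof -
      have "y - x \<in> U" by (rule gauge_fun_less_one_imp_mem[OF cU 0 that abs])
      then show ?thesis using B(4) by (auto simp: U_def)
    qed
  qed
qed

section \<open>Fitzpatrick functions\<close>

lemma phi_le_iff: "phi T z \<le> ereal a \<longleftrightarrow> (\<forall>(u, h) \<in> T. snd z u + h (fst z) - h u \<le> a)"
  by (auto simp: phi_def SUP_le_iff)

lemma phi_mono: "T \<subseteq> T' \<Longrightarrow> phi T z \<le> phi T' z"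
  unfolding phi_def by (rule SUP_subset_mono) auto

lemma dual_combination:
  assumes "f \<in> dual tau" "g \<in> dual tau"
  shows "(\<lambda>v. a * f v + b * g v) \<in> dual tau"
proof -
  have lin: "linear f" "linear g" using assms by (auto simp: dual_def)
  have "linear (\<lambda>v. a * f v + b * g v)"
    by (rule linearI)
      (simp_all add: linear_add[OF lin(1)] linear_add[OF lin(2)] linear_scale[OF lin(1)] linear_scale[OF lin(2)] algebra_simps)
  moreover have "continuous_map tau euclideanreal (\<lambda>v. a * f v + b * g v)"
    using assms by (intro continuous_map_add continuous_map_real_mult_left) (auto simp: dual_def)
  ultimately show ?thesis by (simp add: dual_def)
qed

lemma phi_convex_Z:
  assumes T: "T \<subseteq> Zsp tau"
  shows "convex_Z tau (phi T)"
  unfolding convex_Z_def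
proof (intro ballI allI impI, elim conjE)
  fix z w :: "'a \<times> ('a \<Rightarrow> real)" and t a b :: real
  assume t: "0 < t" "t < 1" and a: "phi T z < ereal a" and b: "phi T w < ereal b"
  \<comment> \<open>A supremum need not preserve strict inequalities, so room below a and b is
    reserved first.\<close>
  obtain a' where a': "phi T z < ereal a'" "a' < a" using ereal_dense2[OF a] by auto
  obtain b' where b': "phi T w < ereal b'" "b' < b" using ereal_dense2[OF b] by auto
  have "phi T (zcomb t z w) \<le> ereal (t * a' + (1 - t) * b')"
    unfolding phi_le_iff
  proof safe
    fix u h assume uh: "(u, h) \<in> T"
    then have h: "linear h" using T by (auto simp: Zsp_def dual_def)
    have "snd z u + h (fst z) - h u \<le> a'" "snd w u + h (fst w) - h u \<le> b'"
      using a' b' uh by (auto dest!: less_imp_le simp: phi_le_iff)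
    then have "t * (snd z u + h (fst z) - h u) + (1 - t) * (snd w u + h (fst w) - h u) \<le> t * a' + (1 - t) * b'"
      using t by (intro add_mono mult_left_mono) auto
    moreover have "h (fst (zcomb t z w)) = t * h (fst z) + (1 - t) * h (fst w)"
      by (simp add: zcomb_def linear_add[OF h] linear_scale[OF h])
    ultimately show "snd (zcomb t z w) u + h (fst (zcomb t z w)) - h u \<le> t * a' + (1 - t) * b'"
      by (simp add: zcomb_def algebra_simps)
  qed
  also have "ereal (t * a' + (1 - t) * b') < ereal (t * a + (1 - t) * b)"
    using a' b' t by (simp add: add_strict_mono)
  finally show "phi T (zcomb t z w) < ereal (t * a + (1 - t) * b)" .
qed

lemma topspace_Ztop: "lcs tau \<Longrightarrow> topspace (Ztop tau) = Zsp tau"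
  by (auto simp: Ztop_def Zsp_def wstar_def lcs_topspace)

lemma phi_lsc_Z:
  assumes lcs: "lcs tau" and T: "T \<subseteq> Zsp tau"
  shows "lsc_Z tau (phi T)"
  unfolding lsc_Z_def
proof
  fix a :: real
  have top: "topspace (Ztop tau) = Zsp tau" by (rule topspace_Ztop[OF lcs])
  have "closedin (Ztop tau) {z \<in> Zsp tau. snd z u + h (fst z) - h u \<le> a}" if "(u, h) \<in> T" for u h
  proof -
    have h: "continuous_map tau euclideanreal h" using that T by (auto simp: Zsp_def dual_def)
    have "continuous_map (Ztop tau) tau fst" "continuous_map (Ztop tau) (wstar tau) snd"
      by (simp_all add: Ztop_def continuous_map_fst continuous_map_snd)
    moreover have "continuous_map (wstar tau) euclideanreal (\<lambda>f. f u)"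
      unfolding wstar_def by (intro continuous_map_from_subtopology continuous_map_product_projection) simp
    ultimately have "continuous_map (Ztop tau) euclideanreal (\<lambda>z. h (fst z))"
        "continuous_map (Ztop tau) euclideanreal (\<lambda>z. snd z u)"
      using h by (auto dest: continuous_map_compose simp: o_def)
    then have "continuous_map (Ztop tau) euclideanreal (\<lambda>z. snd z u + h (fst z) - h u)"
      by (intro continuous_map_add continuous_map_diff) auto
    from closedin_continuous_map_preimage[OF this, of "{..a}"] show ?thesis by (simp add: top)
  qed
  \<comment> \<open>The factor \<open>Zsp tau\<close> covers the empty graph, whose supremum is
    minus infinity and whose sublevel sets are all of Z.\<close>
  then have "closedin (Ztop tau) (Zsp tau \<inter> (\<Inter>p\<in>T. {z \<in> Zsp tau. snd z (fst p) + snd p (fst z) - snd p (fst p) \<le> a}))"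
  proof (cases "T = {}")
    case True
    then show ?thesis using closedin_topspace[of "Ztop tau"] by (simp add: top)
  next
    case False
    assume "\<And>u h. (u, h) \<in> T \<Longrightarrow> closedin (Ztop tau) {z \<in> Zsp tau. snd z u + h (fst z) - h u \<le> a}"
    then show ?thesis using False closedin_topspace[of "Ztop tau"]
      by (intro closedin_Int closedin_INT) (auto simp: top)
  qed
  also have "Zsp tau \<inter> (\<Inter>p\<in>T. {z \<in> Zsp tau. snd z (fst p) + snd p (fst z) - snd p (fst p) \<le> a})
      = {z \<in> Zsp tau. phi T z \<le> ereal a}"
    by (fastforce simp: phi_le_iff)
  finally show "closedin (Ztop tau) {z \<in> Zsp tau. phi T z \<le> ereal a}" .
qed

lemma monotone_phi_le:
  assumes "T \<subseteq> Zsp tau" "monotone_op T" "z \<in> T"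
  shows "phi T z \<le> ereal (cpl z)"
  unfolding phi_le_iff
proof safe
  fix u h assume uh: "(u, h) \<in> T"
  obtain x f where z: "z = (x, f)" by (cases z)
  have lin: "linear h" "linear f" using uh assms(1,3) z by (auto simp: Zsp_def dual_def)
  have "f (x - u) - h (x - u) \<ge> 0" using assms(2,3) uh unfolding z monotone_op_def by blast
  then show "snd z u + h (fst z) - h u \<le> cpl z"
    by (simp add: z cpl_def linear_diff[OF lin(1)] linear_diff[OF lin(2)])
qed

section \<open>Comparison of \<open>psi\<close> with \<open>phi\<close> and the coupling; density of
  the domain\<close>

lemma phi_le_psi:
  assumes "lcs tau" "T \<subseteq> Zsp tau" "monotone_op T"
  shows "phi T z \<le> psi tau T z"
  unfolding psi_def
  \<comment> \<open>\<open>phi T\<close> is itself one of the convex lsc minorants whose supremum is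
    \<open>psi\<close>.\<close>
  using phi_convex_Z[OF assms(2)] phi_lsc_Z[OF assms(1,2)] monotone_phi_le[OF assms(2,3)]
  by (intro SUP_upper) (auto simp: c_plus_ind_def)

lemma psi_antimono:
  assumes "T' \<subseteq> T"
  shows "psi tau T z \<le> psi tau T' z"
  unfolding psi_def
proof (rule SUP_subset_mono)
  have "c_plus_ind T w \<le> c_plus_ind T' w" for w
    using assms by (auto simp: c_plus_ind_def)
  then show "{h. convex_Z tau h \<and> lsc_Z tau h \<and> (\<forall>w\<in>Zsp tau. h w \<le> c_plus_ind T w)}
      \<subseteq> {h. convex_Z tau h \<and> lsc_Z tau h \<and> (\<forall>w\<in>Zsp tau. h w \<le> c_plus_ind T' w)}"
    by (blast intro: order_trans)
qed simp

text \<open>Each term of \<open>phi\<close> is affine in the test point, while the coupling is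
  quadratic along (x, f) + t ((y, g) - l (x, f)). A first-order gap k would push \<open>phi\<close>
  below the coupling for small t, against \<open>V_NI\<close>. The summand with l is the
  contribution of the epigraph coordinate to a separating functional.\<close>

lemma V_NI_no_strict_separation:
  fixes tau :: "'a::real_vector topology"
  assumes lcs: "lcs tau" and V: "open_convex tau V" and NI: "V_NI tau V T" and T: "T \<subseteq> Zsp tau"
    and x: "x \<in> V" and f: "f \<in> dual tau" and phi: "phi (restr T V) (x, f) \<le> ereal (f x)"
    and g: "g \<in> dual tau" and l: "0 \<le> l" and k: "0 < k"
  shows "\<exists>(u, h) \<in> restr T V. f y + g x - l * f x - k < h y + g u - l * h u"
proof (rule ccontr)
  assume "\<not> ?thesis"
  then have sep: "h y + g u - l * h u \<le> f y + g x - l * f x - k" if "(u, h) \<in> restr T V" for u h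
    using that by fastforce
  have lin: "linear f" "linear g" using f g by (auto simp: dual_def)
  \<comment> \<open>Moving from \<open>(x, f)\<close> to \<open>(x, f) + t ((y, g) - l (x, f))\<close> bounds \<open>k\<close> by \<open>t K\<close>.\<close>
  define K where "K = l * (f y + g x) - l * l * f x - g y"
  obtain e where e: "0 < e" "ball 0 e \<subseteq> {t. x + t *\<^sub>R (y - l *\<^sub>R x) \<in> V}"
    using openE[OF lcs_open_line[OF lcs, of V x "y - l *\<^sub>R x"], of 0] V x
    by (auto simp: open_convex_def)
  \<comment> \<open>The three bounds keep x' in V, keep the weight 1 - t l nonnegative, and make the
    second-order error t K smaller than k.\<close>
  define t where "t = min (e / 2) (min (1 / (l + 1)) (k / (2 * (\<bar>K\<bar> + 1))))"
  have t: "0 < t" "t < e" "t \<le> 1 / (l + 1)" "t \<le> k / (2 * (\<bar>K\<bar> + 1))"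
    using e(1) l k by (auto simp: t_def min_less_iff_disj)
  have tl: "t * l \<le> 1" using t(1,3) l by (simp add: field_simps)
  have tK: "t * \<bar>K\<bar> < k"
  proof -
    have "t * (2 * (\<bar>K\<bar> + 1)) \<le> k" using t(4) by (simp add: field_simps)
    moreover have "0 \<le> t * \<bar>K\<bar>" using t(1) by simp
    ultimately show ?thesis using t(1) by (simp only: distrib_left)
  qed
  define x' where "x' = x + t *\<^sub>R (y - l *\<^sub>R x)"
  define f' where "f' = (\<lambda>v. (1 - t * l) * f v + t * g v)"
  have x'_eq: "h x' = (1 - t * l) * h x + t * h y" if "linear h" for h :: "'a \<Rightarrow> real"
    by (simp add: x'_def linear_add[OF that] linear_diff[OF that] linear_scale[OF that] algebra_simps)
  have "t \<in> ball 0 e" using t by simp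
  then have "x' \<in> V" using e(2) by (auto simp: x'_def)
  moreover have "f' \<in> dual tau" unfolding f'_def by (rule dual_combination[OF f g])
  ultimately have "ereal (f' x') \<le> phi (restr T V) (x', f')"
    using NI by (auto simp: V_NI_def cpl_def)
  also have "\<dots> \<le> ereal ((1 - t * l) * f x + t * (f y + g x - l * f x - k))"
    unfolding phi_le_iff
  proof safe
    fix u h assume uh: "(u, h) \<in> restr T V"
    then have h: "linear h" using T by (auto simp: restr_def Zsp_def dual_def)
    have "f u + h x - h u \<le> f x" using phi uh by (auto simp: phi_le_iff)
    \<comment> \<open>The Fitzpatrick term at (x', f') splits exactly with weights 1 - t l and t:
      the constant - h u is shared out as (1 - t l) + t l = 1.\<close>
    then have "(1 - t * l) * (f u + h x - h u) + t * (h y + g u - l * h u)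
        \<le> (1 - t * l) * f x + t * (f y + g x - l * f x - k)"
      using sep[OF uh] tl t(1) by (intro add_mono mult_left_mono) auto
    then show "snd (x', f') u + h (fst (x', f')) - h u \<le> (1 - t * l) * f x + t * (f y + g x - l * f x - k)"
      by (simp add: f'_def x'_eq[OF h] algebra_simps)
  qed
  finally have "(1 - t * l) * ((1 - t * l) * f x + t * f y) + t * ((1 - t * l) * g x + t * g y)
      \<le> (1 - t * l) * f x + t * (f y + g x - l * f x - k)"
    by (simp add: f'_def x'_eq[OF lin(1)] x'_eq[OF lin(2)])
  then have "t * k \<le> t * (t * K)" unfolding K_def by (simp add: algebra_simps)
  then have "k \<le> t * K" using t(1) by simp
  also have "\<dots> \<le> t * \<bar>K\<bar>" using t(1) by (simp add: mult_left_mono)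
  finally show False using tK by simp
qed

text \<open>By the bound, L cannot distinguish f from its part supported on F, a finite combination
  of indicators \<open>d v\<close>. Linearity of f then moves the coefficients
  \<open>L (d v)\<close> inside, so y is the combination of the points of F with these
  coefficients.\<close>

lemma linear_fun_evaluation:
  fixes L :: "('a::real_vector \<Rightarrow> real) \<Rightarrow> real"
  assumes L: "linear L" and F: "finite F" and M: "\<And>f. L f \<le> M * (\<Sum>v\<in>F. \<bar>f v\<bar>)"
  obtains y where "\<And>f. linear f \<Longrightarrow> L f = f y"
proof
  define d where "d v = (\<lambda>w. if w = v then 1 else 0 :: real)" for v :: 'a
  fix f :: "'a \<Rightarrow> real" assume f: "linear f"
  define f0 where "f0 = (\<Sum>v\<in>F. f v *\<^sub>R d v)"
  have sum_apply: "(\<Sum>v\<in>A. f v *\<^sub>R d v) w = (\<Sum>v\<in>A. f v * d v w)" if "finite A" for A w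
    using that by (induction A rule: finite_induct) auto
  have "f0 w = f w" if "w \<in> F" for w
    unfolding f0_def sum_apply[OF F] using F that by (simp add: d_def if_distrib cong: if_cong)
  then have "L (f - f0) \<le> 0" "L (f0 - f) \<le> 0" using M[of "f - f0"] M[of "f0 - f"] by simp_all
  then have "L f = L f0" by (simp add: linear_diff[OF L])
  also have "\<dots> = (\<Sum>v\<in>F. f v * L (d v))"
    by (simp add: f0_def linear_sum[OF L] linear_scale[OF L])
  also have "\<dots> = f (\<Sum>v\<in>F. L (d v) *\<^sub>R v)"
    by (simp add: linear_sum[OF f] linear_scale[OF f] mult.commute)
  finally show "L f = f (\<Sum>v\<in>F. L (d v) *\<^sub>R v)" .
qed

text \<open>The separation takes place in \<open>X \<times> \<real>\<^sup>X \<times> \<real>\<close>: a weak-star neighbourhood involves finitely many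
  evaluations only, so it extends to all functions and the separating functional acts on the dual as
  the evaluation at some \<open>y\<close>.\<close>

lemma V_NI_minorant_le:
  fixes tau :: "'a::real_vector topology"
  assumes lcs: "lcs tau" and V: "open_convex tau V" and NI: "V_NI tau V T" and T: "T \<subseteq> Zsp tau"
    and ne: "restr T V \<noteq> {}"
    and x: "x \<in> V" and f: "f \<in> dual tau" and phi: "phi (restr T V) (x, f) \<le> ereal (f x)"
    and conv: "convex_Z tau H" and lsc: "lsc_Z tau H"
    and le: "\<And>w. w \<in> Zsp tau \<Longrightarrow> H w \<le> c_plus_ind (restr T V) w"
  shows "H (x, f) \<le> ereal (f x)"
proof (rule ccontr)
  assume "\<not> ?thesis"
  then obtain r where r: "f x < r" "ereal r < H (x, f)"
    using ereal_dense2[of "ereal (f x)" "H (x, f)"] by (auto simp: not_le)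
  define G where "G = topspace (Ztop tau) - {z \<in> Zsp tau. H z \<le> ereal r}"
  have "openin (Ztop tau) G"
    unfolding G_def using lsc by (intro openin_diff) (auto simp: lsc_Z_def)
  then have "openin (prod_topology tau (wstar tau)) G" by (simp add: Ztop_def)
  moreover have "(x, f) \<in> G"
    using r f by (auto simp: G_def topspace_Ztop[OF lcs] Zsp_def)
  ultimately have "\<exists>A B. openin tau A \<and> openin (wstar tau) B \<and> x \<in> A \<and> f \<in> B \<and> A \<times> B \<subseteq> G"
    by (rule openin_prod_topology_alt[THEN iffD1, rule_format])
  then obtain A B where AB: "openin tau A" "openin (wstar tau) B" "x \<in> A" "f \<in> B" "A \<times> B \<subseteq> G"
    by blast
  obtain U where U: "openin tau U" "convex U" "0 \<in> U" "\<And>y. y \<in> U \<Longrightarrow> - y \<in> U"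
      "\<And>y. gauge_fun U (y - x) < 1 \<Longrightarrow> y \<in> A" "sublinear (gauge_fun U)"
    using lcs_gauge_neighbourhood[OF lcs AB(1,3)] by blast
  obtain F e where F: "finite F" "0 < e"
      "\<And>g. g \<in> dual tau \<Longrightarrow> (\<And>v. v \<in> F \<Longrightarrow> \<bar>g v - f v\<bar> < e) \<Longrightarrow> g \<in> B"
    using wstar_neighbourhood[OF AB(2,4)] by blast
  define \<delta> where "\<delta> = r - f x"
  have \<delta>: "0 < \<delta>" using r by (simp add: \<delta>_def)
  have gauge_ge: "0 \<le> gauge_fun U v" for v
    unfolding gauge_fun_def using lcs_absorbing[OF lcs U(1,3), of v] by (intro cInf_greatest) auto
  \<comment> \<open>The scaling by e and \<delta> makes \<open>p\<close> < 1 at a displacement from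
    (x, f, f x) force u in A, g in B (for g in the dual) and s < r.\<close>
  define p :: "'a \<times> ('a \<Rightarrow> real) \<times> real \<Rightarrow> real" where
    "p = (\<lambda>(v, g, s). gauge_fun U v + (\<Sum>w\<in>F. \<bar>g w\<bar>) / e + \<bar>s\<bar> / \<delta>)"
  have p: "sublinear p"
  proof (rule sublinearI)
    fix a b :: "'a \<times> ('a \<Rightarrow> real) \<times> real"
    obtain v g s where a: "a = (v, g, s)" by (cases a)
    obtain v' g' s' where b: "b = (v', g', s')" by (cases b)
    have "(\<Sum>w\<in>F. \<bar>g w + g' w\<bar>) \<le> (\<Sum>w\<in>F. \<bar>g w\<bar>) + (\<Sum>w\<in>F. \<bar>g' w\<bar>)"
      unfolding sum.distrib[symmetric] by (intro sum_mono) simp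
    then have "(\<Sum>w\<in>F. \<bar>g w + g' w\<bar>) / e \<le> (\<Sum>w\<in>F. \<bar>g w\<bar>) / e + (\<Sum>w\<in>F. \<bar>g' w\<bar>) / e"
      using F(2) by (simp add: divide_right_mono add_divide_distrib[symmetric])
    moreover have "\<bar>s + s'\<bar> / \<delta> \<le> \<bar>s\<bar> / \<delta> + \<bar>s'\<bar> / \<delta>"
      using \<delta> by (simp add: divide_right_mono add_divide_distrib[symmetric])
    moreover have "gauge_fun U (v + v') \<le> gauge_fun U v + gauge_fun U v'"
      by (rule sublinear_add[OF U(6)])
    ultimately show "p (a + b) \<le> p a + p b"
      unfolding p_def a b add_Pair prod.case plus_fun_apply by linarith
  next
    fix c :: real and a :: "'a \<times> ('a \<Rightarrow> real) \<times> real" assume c: "0 < c"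
    obtain v g s where a: "a = (v, g, s)" by (cases a)
    have "(\<Sum>w\<in>F. \<bar>c * g w\<bar>) = c * (\<Sum>w\<in>F. \<bar>g w\<bar>)"
      unfolding sum_distrib_left using c by (intro sum.cong) (auto simp: abs_mult)
    then show "p (c *\<^sub>R a) \<le> c * p a"
      using c unfolding p_def a scaleR_Pair prod.case
      by (simp add: sublinear_scale_pos[OF U(6)] abs_mult distrib_left)
  qed
  \<comment> \<open>The strict epigraph of \<open>H\<close>, translated so that (x, f, f x) becomes
    the origin. Since H > r on A x B, no point of it has \<open>p\<close> < 1.\<close>
  define C where "C = {(u - x, g - f, s - f x) | u g s. g \<in> dual tau \<and> H (u, g) < ereal s}"
  have C_ne: "(u - x, h - f, s - f x) \<in> C" if "(u, h) \<in> restr T V" "h u < s" for u h s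
  proof -
    have "h \<in> dual tau" using that T by (auto simp: restr_def Zsp_def)
    moreover have "H (u, h) \<le> ereal (h u)"
      using le[of "(u, h)"] that \<open>h \<in> dual tau\<close> by (simp add: c_plus_ind_def cpl_def Zsp_def)
    ultimately show ?thesis using that(2) by (force simp: C_def intro: le_less_trans)
  qed
  have "C \<noteq> {}"
  proof -
    obtain u h where "(u, h) \<in> restr T V" using ne by auto
    from C_ne[OF this, of "h u + 1"] show ?thesis by auto
  qed
  moreover have "convex C"
  proof (rule convexI)
    fix a b :: "'a \<times> ('a \<Rightarrow> real) \<times> real" and t t' :: real
    assume ab: "a \<in> C" "b \<in> C" and t: "0 \<le> t" "0 \<le> t'" "t + t' = 1"
    obtain u g s where a: "a = (u - x, g - f, s - f x)" "g \<in> dual tau" "H (u, g) < ereal s"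
      using ab by (auto simp: C_def)
    obtain u' g' s' where b: "b = (u' - x, g' - f, s' - f x)" "g' \<in> dual tau" "H (u', g') < ereal s'"
      using ab by (auto simp: C_def)
    have t': "t' = 1 - t" using t by simp
    show "t *\<^sub>R a + t' *\<^sub>R b \<in> C"
    proof (cases "t = 0 \<or> t = 1")
      case True
      then show ?thesis using ab t' by auto
    next
      case False
      then have "0 < t" "t < 1" using t by auto
      then have "H (zcomb t (u, g) (u', g')) < ereal (t * s + (1 - t) * s')"
        using conv a b unfolding convex_Z_def by (auto simp: Zsp_def)
      moreover have "(\<lambda>v. t * g v + (1 - t) * g' v) \<in> dual tau" by (rule dual_combination[OF a(2) b(2)])
      moreover have "t *\<^sub>R a + t' *\<^sub>R b = (t *\<^sub>R u + (1 - t) *\<^sub>R u' - x,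
          (\<lambda>v. t * g v + (1 - t) * g' v) - f, (t * s + (1 - t) * s') - f x)"
        by (auto simp: a b t' fun_eq_iff algebra_simps)
      ultimately show ?thesis unfolding C_def zcomb_def by auto
    qed
  qed
  moreover have "1 \<le> p c" if c: "c \<in> C" for c
  proof (rule ccontr)
    assume "\<not> 1 \<le> p c"
    moreover obtain u g s where c: "c = (u - x, g - f, s - f x)" "g \<in> dual tau" "H (u, g) < ereal s"
      using c by (auto simp: C_def)
    ultimately have less: "gauge_fun U (u - x) + (\<Sum>w\<in>F. \<bar>g w - f w\<bar>) / e + \<bar>s - f x\<bar> / \<delta> < 1"
      by (simp add: p_def)
    have nonneg: "0 \<le> (\<Sum>w\<in>F. \<bar>g w - f w\<bar>) / e" "0 \<le> \<bar>s - f x\<bar> / \<delta>"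
      using F(2) \<delta> by (auto intro!: divide_nonneg_pos sum_nonneg)
    have "u \<in> A" using less nonneg by (intro U(5)) linarith
    moreover have "g \<in> B"
    proof (rule F(3)[OF c(2)])
      fix v assume "v \<in> F"
      then have "\<bar>g v - f v\<bar> \<le> (\<Sum>w\<in>F. \<bar>g w - f w\<bar>)" using F(1) by (intro member_le_sum) auto
      moreover have "(\<Sum>w\<in>F. \<bar>g w - f w\<bar>) / e < 1" using less nonneg gauge_ge[of "u - x"] by linarith
      ultimately show "\<bar>g v - f v\<bar> < e" using F(2) by simp
    qed
    ultimately have "ereal r < H (u, g)" using AB(5) c(2) by (auto simp: G_def Zsp_def not_le)
    moreover have "\<bar>s - f x\<bar> / \<delta> < 1" using less nonneg gauge_ge[of "u - x"] by linarith
    then have "s < r" using \<delta> by (simp add: \<delta>_def)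
    ultimately show False using c(3) by (meson ereal_less_eq(3) less_imp_le less_le_trans not_less)
  qed
  ultimately obtain L where L: "linear L" "\<And>a. L a \<le> p a" "\<And>c. c \<in> C \<Longrightarrow> 1 \<le> L c"
    using Hahn_Banach_separation[OF p] by blast
  have split: "L (v, g, s) = L (v, 0, 0) + L (0, g, 0) + s * L (0, 0, 1)" for v g s
  proof -
    have "(v, g, s) = (v, 0, 0) + (0, g, 0) + s *\<^sub>R (0, 0, 1)" by simp
    then show ?thesis by (metis linear_add[OF L(1)] linear_scale[OF L(1)] real_scaleR_def)
  qed
  have "linear (\<lambda>g. L (0, g, 0))"
    using linear_add[OF L(1), of "(0, _, 0)" "(0, _, 0)"] linear_scale[OF L(1), of _ "(0, _, 0)"]
    by (intro linearI) auto
  moreover have "L (0, g, 0) \<le> (1 / e) * (\<Sum>v\<in>F. \<bar>g v\<bar>)" for g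
    using L(2)[of "(0, g, 0)"] sublinear_zero[OF U(6)] by (simp add: p_def)
  ultimately obtain y where y: "\<And>g. linear g \<Longrightarrow> L (0, g, 0) = g y"
    using linear_fun_evaluation[OF _ F(1), of "\<lambda>g. L (0, g, 0)" "1 / e"] by blast
  have "linear (\<lambda>v. L (v, 0, 0))"
    using linear_add[OF L(1), of "(_, 0, 0)" "(_, 0, 0)"] linear_scale[OF L(1), of _ "(_, 0, 0)"]
    by (intro linearI) auto
  moreover have "L (v, 0, 0) \<le> 1" if "v \<in> U" for v
    using L(2)[of "(v, 0, 0)"] gauge_fun_le[of 1 v U] that by (simp add: p_def)
  ultimately have dual: "(\<lambda>v. L (v, 0, 0)) \<in> dual tau"
    by (intro dual_if_bounded_above[OF lcs U(1,3)]) auto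
  \<comment> \<open>With this sign, and - y in place of y, the separation becomes the inequality
    ruled out by \<open>V_NI_no_strict_separation\<close>.\<close>
  define g where "g = (\<lambda>v. - L (v, 0, 0))"
  have g: "g \<in> dual tau" using dual_combination[OF dual dual, of "- 1" 0] by (simp add: g_def)
  define l where "l = L (0, 0, 1)"
  have lin: "linear f" "linear g" using f g by (auto simp: dual_def)
  have sep: "1 \<le> - g (u - x) + (h y - f y) + (s - f x) * l" if "(u, h) \<in> restr T V" "h u < s" for u h s
  proof -
    have h: "linear h" using that T by (auto simp: restr_def Zsp_def dual_def)
    have "L (0, h - f, 0) = L ((0, h, 0) - (0, f, 0))" by simp
    also have "\<dots> = h y - f y" using y[OF h] y[OF lin(1)] by (simp only: linear_diff[OF L(1)])
    finally show ?thesis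
      using L(3)[OF C_ne[OF that]] split[of "u - x" "h - f" "s - f x"] by (simp add: g_def l_def)
  qed
  have l: "0 \<le> l"
  proof (rule ccontr)
    assume neg: "\<not> 0 \<le> l"
    obtain u h where uh: "(u, h) \<in> restr T V" using ne by auto
    define D where "D = \<bar>- g (u - x) + (h y - f y)\<bar>"
    \<comment> \<open>The epigraph is unbounded upwards: at this height a negative l would make the
      right-hand side of \<open>sep\<close> nonpositive.\<close>
    define s where "s = max (h u + 1) (f x + D / (- l))"
    have "D / (- l) \<le> s - f x" "h u < s" by (auto simp: s_def)
    then have "(s - f x) * l \<le> - D" using neg by (simp add: field_simps)
    then show False using sep[OF uh \<open>h u < s\<close>] unfolding D_def by linarith
  qed
  have "\<exists>(u, h) \<in> restr T V. f (- y) + g x - l * f x - 1 / 2 < h (- y) + g u - l * h u"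
    by (rule V_NI_no_strict_separation[OF lcs V NI T x f phi g l]) simp
  then obtain u h where uh: "(u, h) \<in> restr T V"
      and less: "f (- y) + g x - l * f x - 1 / 2 < h (- y) + g u - l * h u" by blast
  have h: "linear h" using uh T by (auto simp: restr_def Zsp_def dual_def)
  \<comment> \<open>The strict epigraph only offers heights above h u. The excess \<epsilon> costs
    at most 1/2, which together with the gap 1/2 chosen above uses up the separation constant
    1.\<close>
  define \<epsilon> where "\<epsilon> = 1 / (2 * (l + 1))"
  have \<epsilon>: "0 < \<epsilon>" "\<epsilon> * l \<le> 1 / 2" using l by (auto simp: \<epsilon>_def field_simps)
  have "1 \<le> - g (u - x) + (h y - f y) + (h u + \<epsilon> - f x) * l" using sep[OF uh, of "h u + \<epsilon>"] \<epsilon> by simp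
  then show False
    using less \<epsilon>(2) by (simp add: linear_neg[OF h] linear_neg[OF lin(1)] linear_diff[OF lin(2)] algebra_simps)
qed

lemma V_NI_psi_le:
  fixes tau :: "'a::real_vector topology"
  assumes "lcs tau" "open_convex tau V" "V_NI tau V T" "T \<subseteq> Zsp tau" "restr T V \<noteq> {}"
    and "z \<in> V \<times> dual tau" "phi (restr T V) z \<le> ereal (cpl z)"
  shows "psi tau (restr T V) z \<le> ereal (cpl z)"
  using assms V_NI_minorant_le[OF assms(1-5)] unfolding psi_def
  by (cases z) (auto simp: cpl_def intro!: SUP_least)

text \<open>If V missed D(T), all of D(T) would have gauge distance at least 1 from x. Local NI on a
  tube from x to a point u0 of D(T) produces a point of D(T) in the tube that a functional growing
  along the tube barely separates from x, which is impossible.\<close>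

lemma locally_NI_dense_domain:
  fixes tau :: "'a::real_vector topology"
  assumes lcs: "lcs tau" and T: "T \<subseteq> Zsp tau" "T \<noteq> {}" and NI: "locally_NI tau T"
    and f: "f \<in> dual tau" and phi: "phi T (x, f) \<le> ereal (f x)"
    and V: "openin tau V" "x \<in> V"
  shows "V \<inter> dom_op T \<noteq> {}"
proof
  assume disj: "V \<inter> dom_op T = {}"
  obtain U where U: "openin tau U" "convex U" "0 \<in> U" "\<And>y. y \<in> U \<Longrightarrow> - y \<in> U"
      "\<And>y. gauge_fun U (y - x) < 1 \<Longrightarrow> y \<in> V" "sublinear (gauge_fun U)"
    using lcs_gauge_neighbourhood[OF lcs V] by blast
  have far: "1 \<le> gauge_fun U (u - x)" if "u \<in> dom_op T" for u
    using U(5)[of u] disj that by (meson disjoint_iff not_le)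
  obtain u0 where u0: "u0 \<in> dom_op T" using T(2) by (auto simp: dom_op_def)
  define m where "m = gauge_fun U (u0 - x)"
  have m: "1 \<le> m" using far[OF u0] by (simp add: m_def)
  \<comment> \<open>The direction is rescaled to gauge 1, so Hahn-Banach for a singleton yields
    \<phi> below the gauge with \<phi> (u0 - x) at least m.\<close>
  have "1 \<le> gauge_fun U c" if "c \<in> {(1 / m) *\<^sub>R (u0 - x)}" for c
    using that m sublinear_scale_pos[OF U(6), of "1 / m" "u0 - x"] by (simp add: m_def)
  then obtain \<phi> where \<phi>: "linear \<phi>" "\<And>v. \<phi> v \<le> gauge_fun U v" "1 \<le> \<phi> ((1 / m) *\<^sub>R (u0 - x))"
    using Hahn_Banach_separation[OF U(6), of "{(1 / m) *\<^sub>R (u0 - x)}" 1] by auto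
  have \<phi>m: "m \<le> \<phi> (u0 - x)" using \<phi>(3) m unfolding linear_scale[OF \<phi>(1)] by (simp add: field_simps)
  have "\<phi> v \<le> 1" if "v \<in> U" for v using \<phi>(2)[of v] gauge_fun_le[of 1 v U] that by simp
  then have "\<phi> \<in> dual tau" by (rule dual_if_bounded_above[OF lcs U(1,3) \<phi>(1)])
  then have dual: "(\<lambda>v. - \<phi> v) \<in> dual tau" using dual_combination[of \<phi> tau \<phi> "- 1" 0] by simp
  \<comment> \<open>Points of \<open>D(T)\<close> in the tube \<open>W\<close> around the segment from \<open>x\<close> to \<open>u0\<close> avoid \<open>x + U\<close>, hence lie
    so far along the segment that \<open>\<phi>\<close> separates them from \<open>x\<close>.\<close>
  define W where "W = (\<Union>s\<in>{0..1}. {w. 3 *\<^sub>R w + (- 3) *\<^sub>R (x + s *\<^sub>R (u0 - x)) \<in> U})"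
  have "openin tau W" unfolding W_def by (intro openin_Union ballI) (auto simp only: image_iff intro!: lcs_openin_affine_vimage[OF lcs U(1)])
  moreover have "convex W"
  proof (rule convexI)
    fix a b :: 'a and t t' :: real
    assume ab: "a \<in> W" "b \<in> W" and t: "0 \<le> t" "0 \<le> t'" "t + t' = 1"
    obtain s where s: "0 \<le> s" "s \<le> 1" "3 *\<^sub>R a + (- 3) *\<^sub>R (x + s *\<^sub>R (u0 - x)) \<in> U"
      using ab by (auto simp: W_def)
    obtain s' where s': "0 \<le> s'" "s' \<le> 1" "3 *\<^sub>R b + (- 3) *\<^sub>R (x + s' *\<^sub>R (u0 - x)) \<in> U"
      using ab by (auto simp: W_def)
    have t': "t' = 1 - t" using t by simp
    have "t *\<^sub>R (3 *\<^sub>R a + (- 3) *\<^sub>R (x + s *\<^sub>R (u0 - x))) + t' *\<^sub>R (3 *\<^sub>R b + (- 3) *\<^sub>R (x + s' *\<^sub>R (u0 - x))) \<in> U"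
      by (rule convexD[OF U(2) s(3) s'(3) t])
    also have "t *\<^sub>R (3 *\<^sub>R a + (- 3) *\<^sub>R (x + s *\<^sub>R (u0 - x))) + t' *\<^sub>R (3 *\<^sub>R b + (- 3) *\<^sub>R (x + s' *\<^sub>R (u0 - x)))
        = 3 *\<^sub>R (t *\<^sub>R a + t' *\<^sub>R b) + (- 3) *\<^sub>R (x + (t * s + t' * s') *\<^sub>R (u0 - x))"
      by (simp add: t' algebra_simps)
    finally have "3 *\<^sub>R (t *\<^sub>R a + t' *\<^sub>R b) + (- 3) *\<^sub>R (x + (t * s + t' * s') *\<^sub>R (u0 - x)) \<in> U" .
    moreover have "t * s + t' * s' \<in> {0..1}"
      using s s' t by (auto intro: convex_bound_le)
    ultimately show "t *\<^sub>R a + t' *\<^sub>R b \<in> W" unfolding W_def by blast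
  qed
  ultimately have oW: "open_convex tau W" by (simp add: open_convex_def)
  have "x \<in> W" unfolding W_def using U(3) by (intro UN_I[of 0]) auto
  have "u0 \<in> W" unfolding W_def using U(3) by (intro UN_I[of 1]) auto
  then have "V_NI tau W T" using NI oW u0 by (auto simp: locally_NI_def)
  moreover have "phi (restr T W) (x, f) \<le> ereal (f x)"
    using phi_mono[of "restr T W" T] phi by (auto simp: restr_def intro: order_trans)
  \<comment> \<open>The choices y = 0 and l = 0 leave only the values of - \<phi>; the gap 1/3 is
    the margin that the tube estimate excludes.\<close>
  ultimately have "\<exists>(u, h) \<in> restr T W. f 0 + - \<phi> x - 0 * f x - 1 / 3 < h 0 + - \<phi> u - 0 * h u"
    by (intro V_NI_no_strict_separation[OF lcs oW _ T(1) \<open>x \<in> W\<close> f _ dual]) auto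
  then obtain u h where uh: "(u, h) \<in> restr T W" "f 0 - \<phi> x - 1 / 3 < h 0 - \<phi> u" by auto
  have "linear f" "linear h" using f uh T by (auto simp: restr_def Zsp_def dual_def)
  then have less: "\<phi> (u - x) < 1 / 3" using uh(2) by (simp add: linear_0 linear_diff[OF \<phi>(1)])
  obtain s where s: "0 \<le> s" "3 *\<^sub>R u + (- 3) *\<^sub>R (x + s *\<^sub>R (u0 - x)) \<in> U"
    using uh(1) by (auto simp: restr_def W_def)
  define v where "v = u - (x + s *\<^sub>R (u0 - x))"
  have v: "3 *\<^sub>R v \<in> U" using s(2) by (simp add: v_def algebra_simps)
  then have "(1 / (1 / 3)) *\<^sub>R v \<in> U" "(1 / (1 / 3)) *\<^sub>R (- v) \<in> U" using U(4)[OF v] by simp_all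
  then have gv: "gauge_fun U v \<le> 1 / 3" "gauge_fun U (- v) \<le> 1 / 3"
    by (intro gauge_fun_le; simp)+
  have eq: "u - x = s *\<^sub>R (u0 - x) + v" by (simp add: v_def)
  have "u \<in> dom_op T" using uh(1) by (force simp: dom_op_def restr_def)
  \<comment> \<open>Gauge distance at least 1 and gauge of v at most 1/3 give s m >= 2/3;
    subtracting \<phi> (- v) <= 1/3 still leaves \<phi> (u - x) >= 1/3.\<close>
  from far[OF this] have "1 \<le> s * m + gauge_fun U v"
    using sublinear_add[OF U(6), of "s *\<^sub>R (u0 - x)" v] s(1)
    unfolding eq by (simp add: sublinear_scale[OF U(6)] m_def)
  moreover have "\<phi> (u - x) = s * \<phi> (u0 - x) - \<phi> (- v)"
    unfolding eq by (simp add: linear_add[OF \<phi>(1)] linear_scale[OF \<phi>(1)] linear_neg[OF \<phi>(1)])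
  moreover have "s * m \<le> s * \<phi> (u0 - x)" using \<phi>m s(1) by (rule mult_left_mono)
  ultimately show False using less gv \<phi>(2)[of "- v"] by linarith
qed

text \<open>By NI and convexity of \<open>phi\<close>, the coupling at the midpoint of two such
  points is at most the mean of their couplings. The difference of these two numbers is a quarter of
  the monotonicity expression.\<close>

lemma NI_phi_le_set_monotone:
  fixes tau :: "'a::real_vector topology"
  assumes T: "T \<subseteq> Zsp tau" and NI: "\<And>z. z \<in> Zsp tau \<Longrightarrow> ereal (cpl z) \<le> phi T z"
  shows "monotone_op {z \<in> Zsp tau. phi T z \<le> ereal (cpl z)}"
  unfolding monotone_op_def
proof safe
  fix x f y g
  assume z: "(x, f) \<in> Zsp tau" "phi T (x, f) \<le> ereal (cpl (x, f))"
    and w: "(y, g) \<in> Zsp tau" "phi T (y, g) \<le> ereal (cpl (y, g))"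
  have lin: "linear f" "linear g" using z w by (auto simp: Zsp_def dual_def)
  define x' where "x' = (1 / 2) *\<^sub>R x + (1 / 2) *\<^sub>R y"
  define f' where "f' = (\<lambda>v. (1 / 2) * f v + (1 / 2) * g v)"
  have x'_eq: "h x' = h x / 2 + h y / 2" if "linear h" for h :: "'a \<Rightarrow> real"
    by (simp add: x'_def linear_add[OF that] linear_scale[OF that])
  have "(x', f') \<in> Zsp tau"
    using z w dual_combination[of f tau g "1 / 2" "1 / 2"] by (simp add: Zsp_def f'_def)
  then have "ereal (f' x') \<le> phi T (x', f')" using NI[of "(x', f')"] by (simp add: cpl_def)
  also have "\<dots> \<le> ereal (f x / 2 + g y / 2)"
    unfolding phi_le_iff
  proof safe
    fix u h assume uh: "(u, h) \<in> T"
    then have h: "linear h" using T by (auto simp: Zsp_def dual_def)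
    have "f u + h x - h u \<le> f x" "g u + h y - h u \<le> g y"
      using z w uh by (auto simp: phi_le_iff cpl_def)
    then show "snd (x', f') u + h (fst (x', f')) - h u \<le> f x / 2 + g y / 2"
      by (simp add: f'_def x'_eq[OF h])
  qed
  finally show "0 \<le> f (x - y) - g (x - y)"
    by (simp add: f'_def x'_eq[OF lin(1)] x'_eq[OF lin(2)] linear_diff[OF lin(1)] linear_diff[OF lin(2)]
        field_simps)
qed

section \<open>The extension by \<open>phi\<close> and \<open>psi\<close>, and its
  uniqueness\<close>

theorem theorem3p8:
  fixes tau :: "'a::real_vector topology"
    and T :: "('a \<times> ('a \<Rightarrow> real)) set"
  assumes "lcs tau"
    and "T \<in> MX tau"
    and "locally_NI tau T"
  defines "S \<equiv> {z \<in> Zsp tau. phi T z = ereal (cpl z)}"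
  shows "S = {z \<in> Zsp tau. phi T z \<le> ereal (cpl z)}
       \<and> S = {z \<in> Zsp tau. psi tau T z = ereal (cpl z)}
       \<and> S \<in> MX tau \<and> T \<subseteq> S \<and> identifiable tau S
       \<and> (\<forall>S' \<in> MX tau. T \<subseteq> S' \<and> identifiable tau S' \<longrightarrow> S' = S)"
proof -
  have T: "T \<subseteq> Zsp tau" "T \<noteq> {}" "monotone_op T" using assms(2) by (auto simp: MX_def)
  have univ: "open_convex tau UNIV"
    using openin_topspace[of tau] by (simp add: open_convex_def lcs_topspace[OF assms(1)])
  have restr_UNIV: "restr R UNIV = R" for R :: "('a \<times> ('a \<Rightarrow> real)) set" by (auto simp: restr_def)
  have "V_NI tau UNIV T"
    using assms(3) univ T(2) by (auto simp: locally_NI_def dom_op_def)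
  then have NI: "ereal (cpl z) \<le> phi T z" if "z \<in> Zsp tau" for z
    using that by (auto simp: V_NI_def restr_UNIV Zsp_def)
  have S_le: "S = {z \<in> Zsp tau. phi T z \<le> ereal (cpl z)}"
    using NI by (auto simp: S_def intro: antisym)
  have S_mono: "monotone_op S" unfolding S_le by (rule NI_phi_le_set_monotone[OF T(1) NI])
  have TS: "T \<subseteq> S" using T(1) monotone_phi_le[OF T(1,3)] by (auto simp: S_le)
  have S_Z: "S \<subseteq> Zsp tau" by (auto simp: S_def)
  have phi_psi: "phi T z \<le> psi tau T z" for z by (rule phi_le_psi[OF assms(1) T(1,3)])
  \<comment> \<open>Restricting to V shrinks the graph and so can only raise \<open>psi\<close>;
    hence a bound obtained on V is inherited by the global \<open>psi\<close>.\<close>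
  have local: "psi tau T z \<le> ereal (cpl z)"
    if V: "open_convex tau V" "V \<inter> dom_op T \<noteq> {}" and z: "z \<in> V \<times> dual tau"
      and le: "phi (restr T V) z \<le> ereal (cpl z)" for V z
  proof -
    have "restr T V \<noteq> {}" using V(2) by (force simp: restr_def dom_op_def)
    moreover have "V_NI tau V T" using assms(3) V by (auto simp: locally_NI_def)
    ultimately have "psi tau (restr T V) z \<le> ereal (cpl z)"
      using V_NI_psi_le[OF assms(1) V(1) _ T(1) _ z le] by blast
    then show ?thesis
      using psi_antimono[of "restr T V" T tau z] by (auto simp: restr_def intro: order_trans)
  qed
  have "S = {z \<in> Zsp tau. psi tau T z = ereal (cpl z)}"
  proof safe
    fix x f assume z: "(x, f) \<in> S"
    then show Z: "(x, f) \<in> Zsp tau" using S_Z by blast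
    have "psi tau T (x, f) \<le> ereal (cpl (x, f))"
      using z Z T(2) by (intro local[OF univ]) (auto simp: S_le restr_UNIV dom_op_def Zsp_def)
    then show "psi tau T (x, f) = ereal (cpl (x, f))"
      using NI[OF Z] phi_psi[of "(x, f)"] by (auto intro: antisym order_trans)
  next
    fix x f assume "(x, f) \<in> Zsp tau" "psi tau T (x, f) = ereal (cpl (x, f))"
    then show "(x, f) \<in> S" using phi_psi[of "(x, f)"] by (simp add: S_le)
  qed
  moreover have "identifiable tau S"
    unfolding identifiable_def identifies_def
  proof (intro allI impI subrelI)
    fix V and x f assume "open_convex tau V \<and> V \<inter> dom_op S \<noteq> {}"
      and "(x, f) \<in> {z \<in> V \<times> dual tau. phi (restr S V) z \<le> ereal (cpl z)}"
    then have V: "open_convex tau V" "V \<inter> dom_op S \<noteq> {}"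
      and z: "x \<in> V" "f \<in> dual tau" "phi (restr S V) (x, f) \<le> ereal (cpl (x, f))" by auto
    obtain y g where y: "y \<in> V" "(y, g) \<in> S" using V(2) by (auto simp: dom_op_def)
    \<comment> \<open>The set V is only known to meet D(S); density of D(T) makes it admissible for
      local NI of T.\<close>
    then have "V \<inter> dom_op T \<noteq> {}"
      using V(1) by (intro locally_NI_dense_domain[OF assms(1) T(1,2) assms(3), of g y])
        (auto simp: S_le Zsp_def cpl_def open_convex_def)
    moreover have "phi (restr T V) (x, f) \<le> ereal (cpl (x, f))"
      using phi_mono[of "restr T V" "restr S V" "(x, f)"] TS z(3) by (auto simp: restr_def intro: order_trans)
    ultimately have "psi tau T (x, f) \<le> ereal (cpl (x, f))"
      using V(1) z by (intro local) auto
    then show "(x, f) \<in> S" using phi_psi[of "(x, f)"] z(2) by (auto simp: S_le Zsp_def intro: order_trans)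
  qed
  \<comment> \<open>Monotonicity of S' gives phi T <= phi S' <= c on S', hence one inclusion. Then
    S, being monotone and larger, gives phi S' <= phi S <= c on S, and identification by the whole
    space returns S into S'.\<close>
  moreover have "S' = S" if S': "S' \<in> MX tau" "T \<subseteq> S'" "identifiable tau S'" for S'
  proof
    have M: "S' \<subseteq> Zsp tau" "S' \<noteq> {}" "monotone_op S'" using S'(1) by (auto simp: MX_def)
    show sub: "S' \<subseteq> S"
    proof
      fix z assume "z \<in> S'"
      then show "z \<in> S"
        using M(1) order_trans[OF phi_mono[OF S'(2)] monotone_phi_le[OF M(1,3)]] by (auto simp: S_le)
    qed
    have "identifies tau UNIV S'"
      using S'(3) univ M(2) by (auto simp: identifiable_def dom_op_def)
    then have "{z \<in> Zsp tau. phi S' z \<le> ereal (cpl z)} \<subseteq> S'"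
      by (simp add: identifies_def restr_UNIV Zsp_def)
    moreover have "phi S' z \<le> ereal (cpl z)" if "z \<in> S" for z
      using monotone_phi_le[OF S_Z S_mono that] phi_mono[OF sub, of z] by (rule order_trans[rotated])
    ultimately show "S \<subseteq> S'" using S_Z by blast
  qed
  moreover have "S \<in> MX tau" using S_mono TS S_Z T(2) by (auto simp: MX_def)
  ultimately show ?thesis using S_le TS by blast
qed

end
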